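(* Let $\mathbb{F}=\mathbb{F}_q$ be the finite field with $q$ elements, let $m,n\ge 1$ be integers, and let $A\in\mathbb{F}^{m\times m}$, $B\in\mathbb{F}^{n\times n}$, $S\in\mathbb{F}^{m\times n}$ be such that the $\mathbb{F}$-linear span of $\{A^iSB^j : i,j\ge 0\}$ is equal to $\mathbb{F}^{m\times n}$. Then, for all integers $0\le h\le m$ and $0\le k\le n$, the set $\mathcal{M}^{h,k}_{A,B;S}=\{p(A)\,S\,r(B) : p\in\mathcal{P}^h[s],\ r\in\mathcal{P}^k[s]\}$ has cardinality $$\left|\mathcal{M}^{h,k}_{A,B;S}\right|=\frac{(q^h-1)(q^k-1)}{q-1}+1.$$
   Context: For an integer $k\ge 0$, $\mathcal{P}^k[s]=\{p(s)\in\mathbb{F}[s] : \deg p<k\}$ denotes the space of polynomials over $\mathbb{F}$ of degree less than $k$ (including the zero polynomial), so that $\mathcal{P}^0[s]=\{0\}$ and $\mathcal{P}^1[s]=\mathbb{F}$. *)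

theory Defs
  imports "HOL-Analysis.Analysis" "HOL-Computational_Algebra.Polynomial"
begin

text \<open>
  The type \<open>'a ^ 'n ^ 'm\<close> consists of the matrices with \<open>CARD('m)\<close> rows and \<open>CARD('n)\<close> columns.
  The library operations \<open>*\<close> and \<open>^\<close> on it act entrywise, and \<open>*s\<close> multiplies by a row vector
  instead of a scalar; hence the following definitions.
\<close>

primrec mat_pow :: "'a::semiring_1 ^ 'n ^ 'n \<Rightarrow> nat \<Rightarrow> 'a ^ 'n ^ 'n" where
  "mat_pow A 0 = mat 1"
| "mat_pow A (Suc i) = A ** mat_pow A i"

definition mat_smult :: "'a::times \<Rightarrow> 'a ^ 'n ^ 'm \<Rightarrow> 'a ^ 'n ^ 'm" where
  "mat_smult c M = map_matrix (\<lambda>x. c * x) M"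

interpretation mat_space: vector_space "mat_smult :: 'a::field \<Rightarrow> 'a ^ 'n ^ 'm \<Rightarrow> 'a ^ 'n ^ 'm"
  by unfold_locales (simp_all add: mat_smult_def vec_eq_iff algebra_simps)

definition poly_mat :: "'a::comm_semiring_1 poly \<Rightarrow> 'a ^ 'n ^ 'n \<Rightarrow> 'a ^ 'n ^ 'n" where
  "poly_mat p A = (\<Sum>i\<le>degree p. mat_smult (coeff p i) (mat_pow A i))"

text \<open>The zero polynomial is listed separately because the library sets \<open>degree 0 = 0\<close>.\<close>

definition polys_below :: "nat \<Rightarrow> 'a::zero poly set" where
  "polys_below k = {p. p = 0 \<or> degree p < k}"

definition poly_products ::
  "'a::comm_semiring_1 ^ 'm ^ 'm \<Rightarrow> 'a ^ 'n ^ 'n \<Rightarrow> 'a ^ 'n ^ 'm \<Rightarrow> nat \<Rightarrow> nat \<Rightarrow> ('a ^ 'n ^ 'm) set"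
where
  "poly_products A B S h k =
     {poly_mat p A ** S ** poly_mat r B | p r. p \<in> polys_below h \<and> r \<in> polys_below k}"

end

theory Submission
  imports Defs
begin

text \<open>
  Every square matrix is annihilated by a nonzero polynomial of degree at most its size, so the
  \<open>m n\<close> matrices \<open>A^i S B^j\<close> with \<open>i < m\<close> and \<open>j < n\<close> already span all \<open>m \<times> n\<close> matrices. As
  there are exactly \<open>q^(m n)\<close> families of coefficients, they form a basis. Hence \<open>p(A) S r(B)\<close>
  determines the products of the coefficients of \<open>p\<close> with those of \<open>r\<close>, that is, the pair
  \<open>(p, r)\<close> up to a scalar moved from one factor to the other once the product is nonzero.
  Normalising \<open>r\<close> to be monic counts the nonzero products.
\<close>

subsection \<open>Evaluating polynomials at matrices\<close>

lemma mat_smult_mult_left: "mat_smult c M ** N = mat_smult c (M ** N)"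
  for c :: "'a::comm_semiring_1"
  by (simp add: mat_smult_def matrix_matrix_mult_def vec_eq_iff sum_distrib_left mult.assoc)

lemma mat_smult_mult_right: "M ** mat_smult c N = mat_smult c (M ** N)"
  for c :: "'a::comm_semiring_1"
  by (simp add: mat_smult_def matrix_matrix_mult_def vec_eq_iff sum_distrib_left ac_simps)

lemma matrix_add_mult_distrib: "(L + M) ** N = L ** N + M ** N"
  for N :: "'a::semiring_1 ^ 'n ^ 'k"
  by (simp add: matrix_matrix_mult_def vec_eq_iff distrib_right sum.distrib)

lemma matrix_mult_sum_left: "(\<Sum>i\<in>I. f i) ** N = (\<Sum>i\<in>I. f i ** N)"
  for N :: "'a::semiring_1 ^ 'n ^ 'k"
  by (induction I rule: infinite_finite_induct) (simp_all add: matrix_add_mult_distrib)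

lemma matrix_mult_sum_right: "N ** (\<Sum>i\<in>I. f i) = (\<Sum>i\<in>I. N ** f i)"
  for N :: "'a::semiring_1 ^ 'n ^ 'k"
  by (induction I rule: infinite_finite_induct) (simp_all add: matrix_add_ldistrib)

text \<open>Padding with zero coefficients gives all polynomials in \<open>polys_below k\<close> the
  same summation bound, which \<open>degree p\<close> does not.\<close>

lemma poly_mat_eq_sum:
  fixes A :: "'a::field ^ 'n ^ 'n"
  assumes "p \<in> polys_below k"
  shows "poly_mat p A = (\<Sum>i<k. mat_smult (coeff p i) (mat_pow A i))"
proof (cases "p = 0")
  case False
  with assms have "{..degree p} \<subseteq> {..<k}"
    by (auto simp: polys_below_def)
  then show ?thesis
    unfolding poly_mat_def by (intro sum.mono_neutral_left) (auto simp: coeff_eq_0)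
qed (simp add: poly_mat_def)

lemma poly_mat_0 [simp]: "poly_mat 0 A = 0" for A :: "'a::field ^ 'n ^ 'n"
  by (simp add: poly_mat_def)

text \<open>Horner's rule, the recursion behind the inductions for sums, scalar multiples and
  products.\<close>

lemma poly_mat_pCons:
  "poly_mat (pCons a p) A = mat_smult a (mat 1) + A ** poly_mat p A" for A :: "'a::field ^ 'n ^ 'n"
proof -
  have below: "pCons a p \<in> polys_below (Suc (Suc (degree p)))" "p \<in> polys_below (Suc (degree p))"
    by (auto simp: polys_below_def)
  show ?thesis
    unfolding poly_mat_eq_sum[OF below(1)] poly_mat_eq_sum[OF below(2)]
      sum.lessThan_Suc_shift[of _ "Suc (degree p)"] matrix_mult_sum_right
    by (simp add: mat_smult_mult_right del: sum.lessThan_Suc)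
qed

lemma poly_mat_add: "poly_mat (p + r) A = poly_mat p A + poly_mat r A"
  for A :: "'a::field ^ 'n ^ 'n"
  by (induction p r rule: poly_induct2)
     (simp_all add: poly_mat_pCons matrix_add_ldistrib mat_space.scale_left_distrib)

lemma poly_mat_smult: "poly_mat (smult c p) A = mat_smult c (poly_mat p A)"
  for A :: "'a::field ^ 'n ^ 'n"
  by (induction p)
     (simp_all add: poly_mat_pCons mat_smult_mult_right mat_space.scale_right_distrib)

lemma poly_mat_diff: "poly_mat (p - r) A = poly_mat p A - poly_mat r A"
  for A :: "'a::field ^ 'n ^ 'n"
  using poly_mat_add[of "p - r" r A] by simp

lemma poly_mat_mult: "poly_mat (p * r) A = poly_mat p A ** poly_mat r A"
  for A :: "'a::field ^ 'n ^ 'n"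
  by (induction p)
     (simp_all add: poly_mat_pCons poly_mat_add poly_mat_smult matrix_add_mult_distrib
       mat_smult_mult_left matrix_mul_assoc)

lemma poly_mat_monom: "poly_mat (monom 1 i) A = mat_pow A i" for A :: "'a::field ^ 'n ^ 'n"
  by (induction i) (simp_all add: monom_0 monom_Suc poly_mat_pCons)

lemma polys_below_0: "polys_below 0 = {0}"
  by (auto simp: polys_below_def)

lemma zero_in_polys_below [simp]: "0 \<in> polys_below k"
  by (simp add: polys_below_def)

text \<open>In coefficient form the zero polynomial is no special case, and closure under sums and
  scalar multiples is immediate.\<close>

lemma polys_below_iff: "p \<in> polys_below k \<longleftrightarrow> (\<forall>i\<ge>k. coeff p i = 0)"
  by (auto simp: polys_below_def coeff_eq_0)
     (metis leading_coeff_0_iff not_le)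

subsection \<open>An annihilating polynomial of small degree\<close>

text \<open>
  An invariant subspace \<open>U\<close> that is killed by a polynomial of degree at most its dimension can be
  enlarged: adjoin the vectors \<open>A^i v\<close> for some \<open>v\<close> outside \<open>U\<close>, up to the first
  dependence modulo \<open>U\<close>.
\<close>

lemma ex_annihilating_poly:
  fixes A :: "'a::field ^ 'n ^ 'n"
  shows "\<exists>p. p \<noteq> 0 \<and> degree p \<le> CARD('n) \<and> poly_mat p A = 0"
proof -
  define good where "good U \<longleftrightarrow> vec.subspace U \<and> (\<forall>u\<in>U. A *v u \<in> U) \<and>
    (\<exists>p. p \<noteq> 0 \<and> degree p \<le> vec.dim U \<and> (\<forall>u\<in>U. poly_mat p A *v u = 0))" for U
  have dim_le: "vec.dim U \<le> CARD('n)" for U :: "('a ^ 'n) set"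
    using vec.dim_subset_UNIV[of U] by (simp add: vec.dimension_def card_cart_basis)
  \<comment> \<open>The constant polynomial 1 has degree 0, the dimension of the zero space.\<close>
  have "good {0}"
    unfolding good_def by (auto intro!: exI[of _ 1] simp: vec.subspace_def)
  then obtain U where U: "good U" and maximal: "\<And>W. good W \<Longrightarrow> vec.dim W \<le> vec.dim U"
    using ex_has_greatest_nat[of good "{0}" vec.dim "CARD('n) + 1"] dim_le
    by (metis Suc_eq_plus1 le_imp_less_Suc)
  from U obtain p where subU: "vec.subspace U" and invU: "\<And>u. u \<in> U \<Longrightarrow> A *v u \<in> U"
    and p: "p \<noteq> 0" "degree p \<le> vec.dim U" "\<And>u. u \<in> U \<Longrightarrow> poly_mat p A *v u = 0"
    unfolding good_def by blast
  have "v \<in> U" for v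
  proof (rule ccontr)
    assume "v \<notin> U"
    define a where "a i = mat_pow A i *v v" for i
    define G where "G d = U \<union> a ` {..<d}" for d
    \<comment> \<open>Each \<open>a i\<close> outside the span of \<open>G i\<close> raises the
      dimension by one, so a first dependence must occur.\<close>
    have dimG: "vec.dim (G d) = vec.dim U + d" if "\<And>i. i < d \<Longrightarrow> a i \<notin> vec.span (G i)" for d
      using that
    proof (induction d)
      case (Suc d)
      have "G (Suc d) = insert (a d) (G d)"
        by (auto simp: G_def lessThan_Suc)
      with Suc show ?case
        by (simp add: vec.dim_insert)
    qed (simp add: G_def)
    have "\<exists>d. a d \<in> vec.span (G d)"
    proof (rule ccontr)
      assume "\<nexists>d. a d \<in> vec.span (G d)"
      then have "vec.dim (G (Suc CARD('n))) = vec.dim U + Suc CARD('n)"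
        by (intro dimG) blast
      with dim_le[of "G (Suc CARD('n))"] show False
        by simp
    qed
    then obtain d where d: "a d \<in> vec.span (G d)" "\<And>i. i < d \<Longrightarrow> a i \<notin> vec.span (G i)"
      using exists_least_iff[of "\<lambda>d. a d \<in> vec.span (G d)"] by blast
    have "d \<noteq> 0"
      using d(1) \<open>v \<notin> U\<close> subU by (metis G_def Un_empty_right a_def image_empty lessThan_0
          mat_pow.simps(1) matrix_vector_mul_lid vec.span_eq_iff)
    define U' where "U' = vec.span (G d)"
    have dimU': "vec.dim U' = vec.dim U + d"
      using dimG d(2) by (simp add: U'_def)
    \<comment> \<open>A subspace containing \<open>G d\<close>, hence its span. It gives the
      dependence the form \<open>a d = u + g(A) v\<close> with \<open>g\<close> in
      \<open>polys_below d\<close>.\<close>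
    define W where "W = {u + poly_mat g A *v v | u g. u \<in> U \<and> g \<in> polys_below d}"
    have "vec.subspace W"
    proof (rule vec.subspaceI)
      show "0 \<in> W"
        unfolding W_def using vec.subspace_0[OF subU]
        by (auto intro!: exI[of _ 0] simp: polys_below_def)
    next
      fix x y assume "x \<in> W" "y \<in> W"
      then obtain u g u' g' where "x = u + poly_mat g A *v v" "y = u' + poly_mat g' A *v v"
        "u \<in> U" "u' \<in> U" "g \<in> polys_below d" "g' \<in> polys_below d"
        unfolding W_def by blast
      moreover from this have "x + y = (u + u') + poly_mat (g + g') A *v v"
        by (simp add: poly_mat_add matrix_vector_mult_add_rdistrib)
      moreover from calculation have "u + u' \<in> U" "g + g' \<in> polys_below d"
        using vec.subspace_add[OF subU] by (auto simp: polys_below_iff)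
      ultimately show "x + y \<in> W"
        unfolding W_def by blast
    next
      fix c x assume "x \<in> W"
      then obtain u g where "x = u + poly_mat g A *v v" "u \<in> U" "g \<in> polys_below d"
        unfolding W_def by blast
      moreover from this have "c *s x = c *s u + poly_mat (smult c g) A *v v"
        by (simp add: poly_mat_smult vec_eq_iff matrix_vector_mult_def mat_smult_def
            sum_distrib_left distrib_left mult.assoc)
      moreover from calculation have "c *s u \<in> U" "smult c g \<in> polys_below d"
        using vec.subspace_scale[OF subU] by (auto simp: polys_below_iff)
      ultimately show "c *s x \<in> W"
        unfolding W_def by blast
    qed
    moreover have "G d \<subseteq> W"
    proof
      fix x assume "x \<in> G d"
      then consider "x \<in> U" | i where "i < d" "x = a i"
        by (auto simp: G_def)
      then show "x \<in> W"
      proof cases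
        case 1
        then show ?thesis
          unfolding W_def by (auto intro!: exI[of _ x] exI[of _ "0 :: 'a poly"] simp: polys_below_def)
      next
        case 2
        then show ?thesis
          unfolding W_def using vec.subspace_0[OF subU]
          by (auto intro!: exI[of _ "0 :: 'a ^ 'n"] exI[of _ "monom 1 i"]
              simp: polys_below_def degree_monom_eq poly_mat_monom a_def)
      qed
    qed
    ultimately have "a d \<in> W"
      using d(1) vec.span_minimal by blast
    then obtain u g where g: "a d = u + poly_mat g A *v v" "u \<in> U" "g \<in> polys_below d"
      unfolding W_def by blast
    \<comment> \<open>The dependence now reads \<open>f(A) v = u\<close>, so \<open>f(A)\<close>
      sends \<open>v\<close> into \<open>U\<close>.\<close>
    define f where "f = monom 1 d - g"
    have f_v: "poly_mat f A *v v \<in> U"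
      using g by (simp add: f_def poly_mat_diff poly_mat_monom matrix_vector_mult_diff_rdistrib
          flip: a_def)
    have "coeff f d = 1"
      using g(3) by (simp add: f_def polys_below_iff)
    then have "f \<noteq> 0"
      by auto
    have "degree f \<le> d"
      using g(3) \<open>d \<noteq> 0\<close> unfolding f_def
      by (intro degree_diff_le) (auto simp: polys_below_def degree_monom_eq)
    have "good U'"
      unfolding good_def
    proof (intro conjI exI)
      show "vec.subspace U'"
        by (simp add: U'_def)
      have "vec.subspace {x. A *v x \<in> U'}"
        unfolding U'_def
        by (rule vec.subspaceI)
           (auto simp: matrix_vector_right_distrib vector_scalar_commute vec.span_zero
             intro: vec.span_add vec.span_scale)
      moreover have "G d \<subseteq> {x. A *v x \<in> U'}"
      proof
        fix x assume "x \<in> G d"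
        then consider "x \<in> U" | i where "i < d" "x = a i"
          by (auto simp: G_def)
        then show "x \<in> {x. A *v x \<in> U'}"
        proof cases
          case 1
          then show ?thesis
            using invU by (auto simp: U'_def G_def intro!: vec.span_base)
        next
          case 2
          then have "A *v x = a (Suc i)"
            by (simp add: a_def matrix_vector_mul_assoc)
          \<comment> \<open>For \<open>Suc i = d\<close> the vector need not lie in
            \<open>G d\<close>; the dependence puts it into the span.\<close>
          moreover have "a (Suc i) \<in> U'"
          proof (cases "Suc i = d")
            case False
            with 2 have "a (Suc i) \<in> G d"
              by (simp add: G_def)
            then show ?thesis
              by (simp add: U'_def vec.span_base)
          qed (use d(1) U'_def in simp)
          ultimately show ?thesis
            by simp
        qed
      qed
      ultimately show "\<forall>u\<in>U'. A *v u \<in> U'"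
        using vec.span_minimal[of "G d" "{x. A *v x \<in> U'}"] U'_def by blast
      \<comment> \<open>\<open>f(A)\<close> sends \<open>v\<close> into \<open>U\<close> and
        \<open>p(A)\<close> kills \<open>U\<close>. The factor \<open>f\<close> adds at most
        \<open>d\<close> to the degree, just what the dimension gains.\<close>
      show "p * f \<noteq> 0"
        using p(1) \<open>f \<noteq> 0\<close> by simp
      show "degree (p * f) \<le> vec.dim U'"
        using degree_mult_le[of p f] p(2) \<open>degree f \<le> d\<close> dimU' by linarith
      have "vec.subspace {x. poly_mat (p * f) A *v x = 0}"
        by (rule vec.subspaceI) (auto simp: matrix_vector_right_distrib vector_scalar_commute)
      moreover have "G d \<subseteq> {x. poly_mat (p * f) A *v x = 0}"
      proof -
        have "poly_mat (p * f) A *v x = 0" if "x \<in> U" for x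
        proof -
          have "poly_mat (p * f) A *v x = poly_mat f A *v (poly_mat p A *v x)"
            by (simp add: mult.commute[of p] poly_mat_mult matrix_vector_mul_assoc)
          with that p(3) show ?thesis
            by simp
        qed
        \<comment> \<open>Polynomials in \<open>A\<close> commute, so \<open>A^i\<close> moves to
          the front and \<open>p(A)\<close> meets \<open>f(A) v\<close>, a vector of
          \<open>U\<close>.\<close>
        moreover have "poly_mat (p * f) A *v a i = 0" for i
        proof -
          have "poly_mat (p * f) A *v a i = poly_mat (p * f * monom 1 i) A *v v"
            by (simp add: poly_mat_mult poly_mat_monom matrix_vector_mul_assoc a_def)
          also have "p * f * monom 1 i = monom 1 i * (p * f)"
            by (rule mult.commute)
          also have "poly_mat \<dots> A *v v = mat_pow A i *v (poly_mat p A *v (poly_mat f A *v v))"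
            by (simp add: poly_mat_mult poly_mat_monom matrix_vector_mul_assoc matrix_mul_assoc)
          finally show ?thesis
            using p(3)[OF f_v] by simp
        qed
        ultimately show ?thesis
          by (auto simp: G_def)
      qed
      ultimately show "\<forall>u\<in>U'. poly_mat (p * f) A *v u = 0"
        using vec.span_minimal[of "G d" "{x. poly_mat (p * f) A *v x = 0}"] U'_def by blast
    qed
    with maximal[of U'] dimU' \<open>d \<noteq> 0\<close> show False
      by simp
  qed
  with p dim_le[of U] show ?thesis
    by (intro exI[of _ p]) (auto simp: matrix_eq)
qed

text \<open>The remainder of \<open>s^i\<close> modulo an annihilating polynomial has the same value
  at \<open>A\<close>.\<close>

lemma mat_pow_eq_poly_mat:
  fixes A :: "'a::field ^ 'n ^ 'n"
  obtains g where "g \<in> polys_below CARD('n)" "mat_pow A i = poly_mat g A"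
proof -
  obtain p where p: "p \<noteq> 0" "degree p \<le> CARD('n)" "poly_mat p A = 0"
    using ex_annihilating_poly by blast
  have "monom 1 i mod p \<in> polys_below CARD('n)"
    using degree_mod_less[OF p(1), of "monom 1 i"] p(2) by (auto simp: polys_below_def)
  moreover have "mat_pow A i = poly_mat (p * (monom 1 i div p) + monom 1 i mod p) A"
    by (simp add: poly_mat_monom)
  then have "mat_pow A i = poly_mat (monom 1 i mod p) A"
    unfolding poly_mat_add poly_mat_mult by (simp add: p(3))
  ultimately show thesis
    using that by blast
qed

subsection \<open>Coefficients of products\<close>

text \<open>By bilinearity, the coefficients form an array of rank at most one, the outer product of
  those of \<open>p\<close> and \<open>r\<close>.\<close>

lemma poly_mat_product_eq_sum:
  fixes A :: "'a::field ^ 'm ^ 'm" and B :: "'a ^ 'n ^ 'n"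
  assumes "p \<in> polys_below h" "r \<in> polys_below k"
  shows "poly_mat p A ** S ** poly_mat r B =
    (\<Sum>(i, j)\<in>{..<h} \<times> {..<k}. mat_smult (coeff p i * coeff r j) (mat_pow A i ** S ** mat_pow B j))"
  unfolding poly_mat_eq_sum[OF assms(1)] poly_mat_eq_sum[OF assms(2)] matrix_mult_sum_left
    matrix_mult_sum_right mat_smult_mult_left mat_smult_mult_right
    mat_space.scale_sum_right sum.cartesian_product[symmetric]
  by (subst sum.swap) (simp add: mult.commute)

text \<open>The map is surjective by the spanning hypothesis, and its domain and codomain are finite of equal size.\<close>

lemma inj_on_coeffs:
  fixes A :: "'a::{field, finite} ^ 'm ^ 'm" and B :: "'a ^ 'n ^ 'n" and S :: "'a ^ 'n ^ 'm"
  assumes span: "mat_space.span {mat_pow A i ** S ** mat_pow B j | i j. True} = UNIV"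
  defines "I \<equiv> {..<CARD('m)} \<times> {..<CARD('n)}"
  shows "inj_on (\<lambda>c. \<Sum>(i, j)\<in>I. mat_smult (c (i, j)) (mat_pow A i ** S ** mat_pow B j))
    (I \<rightarrow>\<^sub>E UNIV)" (is "inj_on ?F ?C")
proof (rule eq_card_imp_inj_on)
  have "finite I" and "card I = CARD('m) * CARD('n)"
    by (simp_all add: I_def card_cartesian_product)
  then show "finite ?C"
    by (intro finite_PiE) auto
  \<comment> \<open>The domain holds extensional functions only; since the sum reads just the values
    on \<open>I\<close>, arbitrary coefficient functions may be used below.\<close>
  have F_restrict: "?F (restrict c I) = ?F c" for c
    by (intro sum.cong) auto
  have F_in: "?F c \<in> ?F ` ?C" for c
    by (rule image_eqI[of _ ?F "restrict c I", OF F_restrict[symmetric]]) simp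
  have subspace: "mat_space.subspace (?F ` ?C)"
  proof (rule mat_space.subspaceI)
    show "0 \<in> ?F ` ?C"
      using F_in[of "\<lambda>_. 0"] by (simp add: case_prod_unfold)
  next
    fix x y assume "x \<in> ?F ` ?C" "y \<in> ?F ` ?C"
    then obtain c c' where "x = ?F c" "y = ?F c'"
      by blast
    then have "x + y = ?F (\<lambda>z. c z + c' z)"
      by (simp add: mat_space.scale_left_distrib case_prod_unfold sum.distrib)
    then show "x + y \<in> ?F ` ?C"
      using F_in by simp
  next
    fix a x assume "x \<in> ?F ` ?C"
    then obtain c where "x = ?F c"
      by blast
    then have "mat_smult a x = ?F (\<lambda>z. a * c z)"
      by (simp add: case_prod_unfold mat_space.scale_sum_right)
    then show "mat_smult a x \<in> ?F ` ?C"
      using F_in by simp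
  qed
  \<comment> \<open>The spanning hypothesis allows all exponents; reducing both powers brings them
    into the range \<open>I\<close>.\<close>
  have gens: "mat_pow A i ** S ** mat_pow B j \<in> ?F ` ?C" for i j
  proof -
    obtain g g' where "g \<in> polys_below CARD('m)" "mat_pow A i = poly_mat g A"
      "g' \<in> polys_below CARD('n)" "mat_pow B j = poly_mat g' B"
      by (metis mat_pow_eq_poly_mat)
    then have "mat_pow A i ** S ** mat_pow B j = ?F (\<lambda>(i, j). coeff g i * coeff g' j)"
      by (simp add: poly_mat_product_eq_sum I_def)
    then show ?thesis
      using F_in[of "\<lambda>(i, j). coeff g i * coeff g' j"] by simp
  qed
  have "UNIV \<subseteq> ?F ` ?C"
    unfolding span[symmetric] by (rule mat_space.span_minimal[OF _ subspace]) (use gens in blast)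
  then have "card (?F ` ?C) = CARD('a ^ 'n ^ 'm)"
    by (simp only: top.extremum_unique)
  also have "\<dots> = CARD('a) ^ card I"
    unfolding \<open>card I = _\<close> CARD_vec power_mult[symmetric] by (simp only: mult.commute)
  also have "\<dots> = card ?C"
    using \<open>finite I\<close> by (simp add: card_PiE)
  finally show "card (?F ` ?C) = card ?C" .
qed

text \<open>For indices in range, both sides are coordinates of the same matrix, unique by
  \<open>inj_on_coeffs\<close>; elsewhere both vanish.\<close>

lemma coeff_mult_eq_if_products_eq:
  fixes A :: "'a::{field, finite} ^ 'm ^ 'm" and B :: "'a ^ 'n ^ 'n" and S :: "'a ^ 'n ^ 'm"
  assumes span: "mat_space.span {mat_pow A i ** S ** mat_pow B j | i j. True} = UNIV"
    and "p \<in> polys_below CARD('m)" "p' \<in> polys_below CARD('m)"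
    and "r \<in> polys_below CARD('n)" "r' \<in> polys_below CARD('n)"
    and eq: "poly_mat p A ** S ** poly_mat r B = poly_mat p' A ** S ** poly_mat r' B"
  shows "coeff p i * coeff r j = coeff p' i * coeff r' j"
proof (cases "i < CARD('m) \<and> j < CARD('n)")
  case True
  let ?I = "{..<CARD('m)} \<times> {..<CARD('n)}"
  let ?c = "\<lambda>p r. restrict (\<lambda>(i, j). coeff p i * coeff r j) ?I"
  have sum_eq: "(\<Sum>(i, j)\<in>?I. mat_smult (?c p r (i, j)) (mat_pow A i ** S ** mat_pow B j)) =
      poly_mat p A ** S ** poly_mat r B"
    if "p \<in> polys_below CARD('m)" "r \<in> polys_below CARD('n)" for p r
    unfolding poly_mat_product_eq_sum[OF that] by (intro sum.cong) auto
  have "?c p r = ?c p' r'"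
    by (rule inj_onD[OF inj_on_coeffs[OF span]]) (use assms sum_eq in auto)
  then have "?c p r (i, j) = ?c p' r' (i, j)"
    by simp
  then show ?thesis
    using True by simp
next
  case False
  then show ?thesis
    using assms(2-5) by (auto simp: polys_below_iff)
qed

subsection \<open>Counting\<close>

lemma card_polys_below: "card (polys_below k :: 'a::{field, finite} poly set) = CARD('a) ^ k"
  and finite_polys_below: "finite (polys_below k :: 'a::{field, finite} poly set)"
proof (induction k)
  case (Suc k)
  have eq: "polys_below (Suc k) = case_prod pCons ` (UNIV \<times> polys_below k :: ('a \<times> 'a poly) set)"
  proof (intro equalityI subsetI)
    fix p :: "'a poly" assume p: "p \<in> polys_below (Suc k)"
    show "p \<in> case_prod pCons ` (UNIV \<times> polys_below k)"
    proof (cases p)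
      case (pCons a g)
      with p have "g \<in> polys_below k"
        by (auto simp: polys_below_def split: if_splits)
      with pCons show ?thesis
        by force
    qed
  qed (auto simp: polys_below_def split: if_splits)
  have inj: "inj_on (case_prod pCons) (UNIV \<times> polys_below k :: ('a \<times> 'a poly) set)"
    by (auto simp: inj_on_def)
  {
    case 1
    show ?case
      by (simp add: eq card_image[OF inj] card_cartesian_product Suc)
  next
    case 2
    show ?case
      by (simp add: eq Suc)
  }
qed (simp_all add: polys_below_0)

text \<open>Every nonzero polynomial is a nonzero scalar times a monic one in exactly one way. The
  product form avoids division of naturals.\<close>

lemma card_monic_polys_below:
  "card {r \<in> polys_below k :: 'a::{field, finite} poly set. lead_coeff r = 1} * (CARD('a) - 1) =
    CARD('a) ^ k - 1" (is "card ?M * _ = _")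
proof -
  let ?f = "\<lambda>(r, c). smult c r"
  have "inj_on ?f (?M \<times> (UNIV - {0}))"
  proof (rule inj_onI)
    fix z z' assume "z \<in> ?M \<times> (UNIV - {0})" "z' \<in> ?M \<times> (UNIV - {0})" and eq: "?f z = ?f z'"
    then obtain r c r' c' where z: "z = (r, c)" "z' = (r', c')"
      and *: "lead_coeff r = 1" "lead_coeff r' = 1" "c \<noteq> 0"
      by auto
    from eq z have "smult c r = smult c' r'"
      by simp
    moreover from this * have "c = c'"
      by (metis lead_coeff_smult mult.right_neutral)
    ultimately show "z = z'"
      using z * smult_cancel by blast
  qed
  then have "card (?f ` (?M \<times> (UNIV - {0}))) = card ?M * (CARD('a) - 1)"
    by (simp add: card_image card_cartesian_product card_Diff_singleton)
  moreover have "?f ` (?M \<times> (UNIV - {0})) = polys_below k - {0}"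
  proof (intro equalityI subsetI)
    fix r assume r: "r \<in> polys_below k - {0 :: 'a poly}"
    then have "r = ?f (smult (inverse (lead_coeff r)) r, lead_coeff r)"
      "(smult (inverse (lead_coeff r)) r, lead_coeff r) \<in> ?M \<times> (UNIV - {0})"
      by (auto simp: polys_below_def)
    then show "r \<in> ?f ` (?M \<times> (UNIV - {0}))"
      by (rule image_eqI)
  qed (auto simp: polys_below_def)
  ultimately show ?thesis
    by (simp add: card_Diff_singleton card_polys_below)
qed

text \<open>For fixed \<open>i\<close> the equations say that two multiples of monic polynomials
  agree. Leading coefficients identify the scalars, and a nonzero scalar cancels.\<close>

lemma monic_factorization_unique:
  fixes p p' r r' :: "'a::field poly"
  assumes eq: "\<And>i j. coeff p i * coeff r j = coeff p' i * coeff r' j"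
    and "p \<noteq> 0" "lead_coeff r = 1" "lead_coeff r' = 1"
  shows "p = p'" "r = r'"
proof -
  have smult_eq: "smult (coeff p i) r = smult (coeff p' i) r'" for i
    by (simp add: poly_eq_iff eq)
  have coeff_eq: "coeff p i = coeff p' i" for i
    using arg_cong[OF smult_eq[of i], of lead_coeff] assms(3,4)
    unfolding lead_coeff_smult by simp
  then show "p = p'"
    by (simp add: poly_eq_iff)
  show "r = r'"
    using smult_eq[of "degree p"] coeff_eq[of "degree p"] \<open>p \<noteq> 0\<close>
    by (metis leading_coeff_0_iff smult_cancel)
qed

theorem theorem5p1:
  fixes A :: "'a::{field, finite} ^ 'm ^ 'm"
    and B :: "'a ^ 'n ^ 'n"
    and S :: "'a ^ 'n ^ 'm"
    and q h k :: nat
  assumes "CARD('a) = q"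
    and "mat_space.span {mat_pow A i ** S ** mat_pow B j | i j. True} = UNIV"
    and "h \<le> CARD('m)" and "k \<le> CARD('n)"
  shows "real (card (poly_products A B S h k)) =
           (real q ^ h - 1) * (real q ^ k - 1) / (real q - 1) + 1"
proof -
  let ?M = "{r \<in> polys_below k :: 'a poly set. lead_coeff r = 1}"
  \<comment> \<open>One representative of each pair of nonzero polynomials up to moving a scalar
    between the factors.\<close>
  let ?D = "(polys_below h - {0 :: 'a poly}) \<times> ?M"
  let ?f = "\<lambda>(p, r). poly_mat p A ** S ** poly_mat r B"
  have below: "p \<in> polys_below CARD('m)" "r \<in> polys_below CARD('n)"
    if "p \<in> polys_below h" "r \<in> polys_below k" for p r :: "'a poly"
    using that assms(3,4) by (auto simp: polys_below_def)
  note coeff_eq = coeff_mult_eq_if_products_eq[OF assms(2)]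
  have inj: "inj_on ?f ?D"
  proof (rule inj_onI)
    fix z z' assume "z \<in> ?D" "z' \<in> ?D" "?f z = ?f z'"
    then obtain p r p' r' where z: "z = (p, r)" "z' = (p', r')"
      and *: "p \<in> polys_below h" "p' \<in> polys_below h" "r \<in> polys_below k" "r' \<in> polys_below k"
      "poly_mat p A ** S ** poly_mat r B = poly_mat p' A ** S ** poly_mat r' B"
      "p \<noteq> 0" "lead_coeff r = 1" "lead_coeff r' = 1"
      by (cases z; cases z') auto
    have "coeff p i * coeff r j = coeff p' i * coeff r' j" for i j
      using * by (intro coeff_eq below[of p r] below[of p' r'])
    with * z show "z = z'"
      using monic_factorization_unique by blast
  qed
  have zero: "0 \<notin> ?f ` ?D"
  proof
    assume "0 \<in> ?f ` ?D"
    then obtain p r where *: "p \<in> polys_below h" "p \<noteq> 0" "r \<in> ?M"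
      "poly_mat p A ** S ** poly_mat r B = 0"
      by force
    \<comment> \<open>The pair \<open>(0, 0)\<close> also has product 0; the two pairs are compared
      at the position of the leading coefficients.\<close>
    then have "lead_coeff p * lead_coeff r = coeff 0 (degree p) * coeff 0 (degree r)"
      by (intro coeff_eq below[of p r]) (auto simp: polys_below_def)
    with * show False
      by simp
  qed
  have eq: "poly_products A B S h k = insert 0 (?f ` ?D)"
  proof (intro equalityI subsetI)
    fix x assume "x \<in> poly_products A B S h k"
    then obtain p r where x: "x = poly_mat p A ** S ** poly_mat r B"
      "p \<in> polys_below h" "r \<in> polys_below k"
      unfolding poly_products_def by blast
    show "x \<in> insert 0 (?f ` ?D)"
    proof (cases "p = 0 \<or> r = 0")
      case True
      with x show ?thesis
        by auto
    next
      case False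
      let ?c = "lead_coeff r"
      \<comment> \<open>Moving the leading coefficient of \<open>r\<close> to \<open>p\<close> keeps
        the product and makes the second factor monic.\<close>
      have "x = ?f (smult ?c p, smult (inverse ?c) r)"
        using False x(1)
        by (simp add: poly_mat_smult mat_smult_mult_left mat_smult_mult_right)
      moreover have "(smult ?c p, smult (inverse ?c) r) \<in> ?D"
        using False x(2,3) by (auto simp: polys_below_def)
      ultimately show ?thesis
        by blast
    qed
  next
    have "0 \<in> poly_products A B S h k"
      unfolding poly_products_def by (auto intro!: exI[of _ 0] simp: polys_below_def)
    moreover have "?f ` ?D \<subseteq> poly_products A B S h k"
      unfolding poly_products_def by force
    ultimately show "x \<in> poly_products A B S h k" if "x \<in> insert 0 (?f ` ?D)" for x
      using that by blast
  qed
  have finite: "finite ?D"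
    by (simp add: finite_polys_below)
  have "card (poly_products A B S h k) = Suc (card ?D)"
    unfolding eq card_insert_disjoint[OF finite_imageI[OF finite] zero] card_image[OF inj] ..
  also have "card ?D = (q ^ h - 1) * card ?M"
    using assms(1)
    by (simp add: card_cartesian_product card_Diff_singleton card_polys_below)
  finally have card: "card (poly_products A B S h k) = Suc ((q ^ h - 1) * card ?M)" .
  \<comment> \<open>Makes \<open>real q - 1\<close> a nonzero divisor and keeps the natural
    subtractions from truncating when passing to reals.\<close>
  have "1 < q"
    using assms(1) card_mono[of UNIV "{0, 1 :: 'a}"] by simp
  have "real (card ?M) * (real q - 1) = real q ^ k - 1"
    using arg_cong[OF card_monic_polys_below[where ?'a = 'a, of k], of real] \<open>1 < q\<close> assms(1)
    by simp
  then have "real (card ?M) = (real q ^ k - 1) / (real q - 1)"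
    using \<open>1 < q\<close> by (simp add: field_simps)
  with card \<open>1 < q\<close> show ?thesis
    by simp
qed

end
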